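(* Let $a,b\ge1$, $P=[a]\times[b]$, $n=a+b$. For $1\le i\le a$, $1\le j\le b$ and $1\le k\le n-1$ define functionals on $(\mathbb R^+)^P$ by $$F_{i,j}(f)=\log\bigl(f(i,j)\,f(a+1-i,b+1-j)\bigr),\qquad F_k(f)=\log\Bigl(\prod_{(i,j)\in P:\ j-i=k-a}f(i,j)\Bigr).$$ Each of these functionals is $0$-mesic under $\rho_{\mathcal B}$ and under $\pi_{\mathcal B}$: for each such $F$, each $T\in\{\rho_{\mathcal B},\pi_{\mathcal B}\}$ and every $f\in(\mathbb R^+)^P$, $\sum_{m=0}^{n-1}F(T^m(f))=0$.
   Context: $[a]\times[b]=\{(i,j)\in\mathbb Z^2:1\le i\le a,\ 1\le j\le b\}$ with the product order. Let $\widehat P=P\cup\{\hat0,\hat1\}$ with $\hat0<x<\hat1$ for all $x\in P$; write $y\lessdot x$ for covering relations; $x^+=\{y\in\widehat P:y\gtrdot x\}$, $x^-=\{y\in\widehat P:y\lessdot x\}$. Each $f:P\to\mathbb R^+$ is extended by $\hat f(\hat0)=\hat f(\hat1)=1$. Parallel sum: $s_1\parallel\cdots\parallel s_m=(1/s_1+\cdots+1/s_m)^{-1}$. The birational toggle $\tau_x$ changes only the value at $x$: $(\tau_xf)(x)=\frac{1}{f(x)}\bigl(\sum_{y\in x^-}\hat f(y)\bigr)\bigl(\|_{y\in x^+}\hat f(y)\bigr)$. Birational rowmotion $\rho_{\mathcal B}=\tau_{x_1}\circ\cdots\circ\tau_{x_p}$ for any linear extension $x_1,\dots,x_p$ of $P$.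 The $k$-th file is $\{(i,j)\in P:j-i+a=k\}$; $\tau^*_k$ is the composition of the toggles over file $k$; birational promotion $\pi_{\mathcal B}=\tau^*_{n-1}\circ\cdots\circ\tau^*_1$. Both maps satisfy $T^n=\mathrm{id}$ on $(\mathbb R^+)^P$. *)

theory Defs
  imports Complex_Main
begin

type_synonym elt = "nat \<times> nat"

definition rect :: "nat \<Rightarrow> nat \<Rightarrow> elt set" where
  "rect a b = {(i,j). 1 \<le> i \<and> i \<le> a \<and> 1 \<le> j \<and> j \<le> b}"

definition pless :: "elt \<Rightarrow> elt \<Rightarrow> bool" where
  "pless x y = (fst x \<le> fst y \<and> snd x \<le> snd y \<and> x \<noteq> y)"

definition covby :: "elt set \<Rightarrow> elt \<Rightarrow> elt \<Rightarrow> bool" where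
  "covby P y x = (y \<in> P \<and> x \<in> P \<and> pless y x \<and> \<not> (\<exists>z\<in>P. pless y z \<and> pless z x))"

definition lowers :: "elt set \<Rightarrow> elt \<Rightarrow> elt set" where
  "lowers P x = {y. covby P y x}"

definition uppers :: "elt set \<Rightarrow> elt \<Rightarrow> elt set" where
  "uppers P x = {y. covby P x y}"

text \<open>Sum of hat-f over x^- in P-hat: the element 0-hat (value 1) is covered by x
  exactly when x has no lower cover in P; dually for 1-hat and the parallel sum.\<close>
definition down_sum :: "elt set \<Rightarrow> (elt \<Rightarrow> real) \<Rightarrow> elt \<Rightarrow> real" where
  "down_sum P f x = (\<Sum>y\<in>lowers P x. f y) + (if lowers P x = {} then 1 else 0)"

definition up_par :: "elt set \<Rightarrow> (elt \<Rightarrow> real) \<Rightarrow> elt \<Rightarrow> real" where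
  "up_par P f x = 1 / ((\<Sum>y\<in>uppers P x. 1 / f y) + (if uppers P x = {} then 1 else 0))"

definition btoggle :: "elt set \<Rightarrow> elt \<Rightarrow> (elt \<Rightarrow> real) \<Rightarrow> (elt \<Rightarrow> real)" where
  "btoggle P x f = f(x := down_sum P f x * up_par P f x / f x)"

definition linear_extension :: "elt set \<Rightarrow> elt list \<Rightarrow> bool" where
  "linear_extension P L = (distinct L \<and> set L = P \<and>
     (\<forall>i j. i < j \<and> j < length L \<longrightarrow> \<not> pless (L ! j) (L ! i)))"

definition brow :: "elt set \<Rightarrow> elt list \<Rightarrow> (elt \<Rightarrow> real) \<Rightarrow> (elt \<Rightarrow> real)" where
  "brow P L f = foldr (btoggle P) L f"

definition rect_list :: "nat \<Rightarrow> nat \<Rightarrow> elt list" where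
  "rect_list a b = [(i,j). i \<leftarrow> [1..<a+1], j \<leftarrow> [1..<b+1]]"

definition file_list :: "nat \<Rightarrow> nat \<Rightarrow> nat \<Rightarrow> elt list" where
  "file_list a b k = filter (\<lambda>(i,j). int j - int i + int a = int k) (rect_list a b)"

definition file_toggle :: "nat \<Rightarrow> nat \<Rightarrow> nat \<Rightarrow> (elt \<Rightarrow> real) \<Rightarrow> (elt \<Rightarrow> real)" where
  "file_toggle a b k f = foldr (btoggle (rect a b)) (file_list a b k) f"

definition bpro :: "nat \<Rightarrow> nat \<Rightarrow> (elt \<Rightarrow> real) \<Rightarrow> (elt \<Rightarrow> real)" where
  "bpro a b f = fold (file_toggle a b) [1..<a+b] f"

definition F_ij :: "nat \<Rightarrow> nat \<Rightarrow> nat \<Rightarrow> nat \<Rightarrow> (elt \<Rightarrow> real) \<Rightarrow> real" where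
  "F_ij a b i j f = ln (f (i,j) * f (a + 1 - i, b + 1 - j))"

definition F_k :: "nat \<Rightarrow> nat \<Rightarrow> nat \<Rightarrow> (elt \<Rightarrow> real) \<Rightarrow> real" where
  "F_k a b k f = ln (\<Prod>x\<in>{(i,j). (i,j) \<in> rect a b \<and> int j - int i = int k - int a}. f x)"

end

theory Submission
  imports Defs
begin

text \<open>
  Write $f_m = \rho^m f$ and $W_m(v) = f_m(v) / \sum_{u \lessdot v} f_m(u)$. Rowmotion says that
  $f_m(v)$ and $1/f_{m+1}(v)$ are both sums over lattice paths weighted by the same $W_m$: paths
  from $(1,1)$ to $v$ and from $v$ to $(a,b)$ respectively. A conversion lemma in the style of
  Grinberg and Roby turns path sums from the first to the last column for $W_{m+1}$ into those
  for $W_m$ shifted by one row, which gives reciprocity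
  $f_{m+i+j-1}(i,j) \, f_m(a+1-i,b+1-j) = 1$ for $j = 1$. Since
  $(m,i,j) \mapsto 1/f_{m-(i+j-1)}(a+1-i,b+1-j)$ satisfies the same recurrence as $f$, reciprocity
  spreads from column to column. Reciprocity implies $\rho^{a+b} = \mathrm{id}$ and the
  antipodal homomesy.

  Promotion orbits are the sheared rowmotion orbits $g_m(i,j) = f_{m+j}(i,j)$. For these the
  sums of covers along a file cancel, so the total log $s_k$ of file $k$ over a period satisfies
  $2 s_k = s_{k-1} + s_{k+1}$ with $s_0 = s_{a+b} = 0$, whence $s_k = 0$.
\<close>

section \<open>Covering relations and neighbour sums in the rectangle\<close>

text \<open>Boundary conventions: \<^term>\<open>lower_val\<close> places the bottom element at $(1,0)$, and
  \<^term>\<open>upper_inv\<close>, which holds reciprocals, places the top element at $(a,b+1)$. All other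
  positions next to the rectangle get $0$, so that every element has exactly two lower and
  two upper summands.\<close>

definition lower_val :: "(elt \<Rightarrow> real) \<Rightarrow> nat \<Rightarrow> nat \<Rightarrow> real" where
  "lower_val f i j = (if i = 0 then 0 else if j = 0 then (if i = 1 then 1 else 0) else f (i, j))"

definition upper_inv :: "nat \<Rightarrow> nat \<Rightarrow> (elt \<Rightarrow> real) \<Rightarrow> nat \<Rightarrow> nat \<Rightarrow> real" where
  "upper_inv a b f i j = (if a < i then 0 else if b < j then (if i = a then 1 else 0) else 1 / f (i, j))"

lemma mem_rect: "(i, j) \<in> rect a b \<longleftrightarrow> 1 \<le> i \<and> i \<le> a \<and> 1 \<le> j \<and> j \<le> b"
  by (simp add: rect_def)

lemma finite_rect: "finite (rect a b)"
  by (rule finite_subset[of _ "{1..a} \<times> {1..b}"]) (auto simp: rect_def)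

lemma covby_rect:
  "covby (rect a b) (i', j') (i, j) \<longleftrightarrow> (i', j') \<in> rect a b \<and> (i, j) \<in> rect a b \<and>
     ((i = Suc i' \<and> j = j') \<or> (i = i' \<and> j = Suc j'))" (is "?L \<longleftrightarrow> ?R")
proof
  assume L: ?L
  then have r: "(i', j') \<in> rect a b" "(i, j) \<in> rect a b" and le: "i' \<le> i" "j' \<le> j" "(i',j') \<noteq> (i,j)"
    and no: "\<And>z. z \<in> rect a b \<Longrightarrow> pless (i', j') z \<Longrightarrow> pless z (i, j) \<Longrightarrow> False"
    by (auto simp: covby_def pless_def)
  show ?R
  \<comment> \<open>One step in a coordinate that is still too small stays weakly below
    \<open>(i, j)\<close>, so covering forces it to hit \<open>(i, j)\<close>.\<close>
  proof (cases "i' < i")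
    case True
    with r le no[of "(Suc i', j')"] show ?thesis by (auto simp: mem_rect pless_def)
  next
    case False
    with r le no[of "(i', Suc j')"] show ?thesis by (auto simp: mem_rect pless_def)
  qed
next
  assume ?R
  then show ?L by (auto simp: covby_def pless_def)
qed

lemma lowers_rect:
  assumes "(i, j) \<in> rect a b"
  shows "lowers (rect a b) (i, j) =
    (if 1 < i then {(i - 1, j)} else {}) \<union> (if 1 < j then {(i, j - 1)} else {})"
  using assms by (auto simp: lowers_def covby_rect mem_rect)

lemma uppers_rect:
  assumes "(i, j) \<in> rect a b"
  shows "uppers (rect a b) (i, j) =
    (if i < a then {(Suc i, j)} else {}) \<union> (if j < b then {(i, Suc j)} else {})"
  using assms by (auto simp: uppers_def covby_rect mem_rect)

lemma down_sum_rect: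
  assumes "(i, j) \<in> rect a b"
  shows "down_sum (rect a b) f (i, j) = lower_val f (i - 1) j + lower_val f i (j - 1)"
  using assms by (auto simp: down_sum_def lowers_rect[OF assms] lower_val_def mem_rect)

lemma up_par_rect:
  assumes "(i, j) \<in> rect a b"
  shows "up_par (rect a b) f (i, j) = 1 / (upper_inv a b f (Suc i) j + upper_inv a b f i (Suc j))"
  using assms by (auto simp: up_par_def uppers_rect[OF assms] upper_inv_def mem_rect)

lemma lower_sum_pos:
  assumes "(i, j) \<in> rect a b" "\<And>x. x \<in> rect a b \<Longrightarrow> 0 < f x"
  shows "0 < lower_val f (i - 1) j + lower_val f i (j - 1)"
proof -
  consider "i = 1" "j = 1" | "i = 1" "1 < j" | "1 < i" "j = 1" | "1 < i" "1 < j"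
    using assms(1) by (auto simp: mem_rect) linarith
  then show ?thesis
    using assms(1) by cases (auto simp: lower_val_def mem_rect intro!: add_pos_pos assms(2))
qed

lemma upper_sum_pos:
  assumes "(i, j) \<in> rect a b" "\<And>x. x \<in> rect a b \<Longrightarrow> 0 < f x"
  shows "0 < upper_inv a b f (Suc i) j + upper_inv a b f i (Suc j)"
proof -
  consider "i = a" "j = b" | "i = a" "j < b" | "i < a" "j = b" | "i < a" "j < b"
    using assms(1) by (auto simp: mem_rect) linarith
  then show ?thesis
    using assms(1) by cases (auto simp: upper_inv_def mem_rect intro!: add_pos_pos assms(2))
qed

section \<open>Compositions of toggles\<close>

lemma foldr_btoggle_outside: "x \<notin> set ys \<Longrightarrow> foldr (btoggle P) ys f x = f x"
  by (induction ys) (auto simp: btoggle_def)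

lemma down_sum_cong:
  "(\<And>z. z \<in> lowers P x \<Longrightarrow> f z = g z) \<Longrightarrow> down_sum P f x = down_sum P g x"
  by (simp add: down_sum_def)

lemma up_par_cong:
  "(\<And>z. z \<in> uppers P x \<Longrightarrow> f z = g z) \<Longrightarrow> up_par P f x = up_par P g x"
  by (simp add: up_par_def)

text \<open>\<^term>\<open>T x z\<close> says that $z$ has already been toggled when $x$ is; only the pairs in a
  covering relation matter.\<close>

lemma foldr_btoggle_partial:
  fixes f :: "elt \<Rightarrow> real"
  assumes "distinct ys"
    and "sorted_wrt (\<lambda>x y. covby P x y \<or> covby P y x \<longrightarrow> T x y \<and> \<not> T y x) ys"
    and "x \<in> set ys"
  defines "h \<equiv> foldr (btoggle P) ys f"
  shows "h x = down_sum P (\<lambda>z. if z \<in> set ys \<and> T x z then h z else f z) x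
             * up_par P (\<lambda>z. if z \<in> set ys \<and> T x z then h z else f z) x / f x"
  using assms(1-3) unfolding h_def
proof (induction ys arbitrary: x)
  case Nil
  then show ?case by simp
next
  case (Cons y ys)
  define h' where "h' = foldr (btoggle P) ys f"
  define h where "h = foldr (btoggle P) (y # ys) f"
  have h: "h = h'(y := down_sum P h' y * up_par P h' y / h' y)"
    by (simp add: h_def h'_def btoggle_def)
  have out: "z \<notin> set ys \<Longrightarrow> h' z = f z" for z
    unfolding h'_def by (rule foldr_btoggle_outside)
  have y: "y \<notin> set ys" using Cons.prems by simp
  let ?mix = "\<lambda>x z. if z \<in> set (y # ys) \<and> T x z then h z else f z"
  have nb: "covby P y z \<or> covby P z y \<Longrightarrow> T y z \<and> \<not> T z y" if "z \<in> set ys" for z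
    using Cons.prems(2) that by auto
  have irr: "\<not> covby P z z" for z by (auto simp: covby_def pless_def)
  have "h x = down_sum P (?mix x) x * up_par P (?mix x) x / f x"
  proof (cases "x = y")
    case True
    \<comment> \<open>\<open>foldr\<close> toggles the head \<open>y\<close> last, so the state
      \<open>h'\<close> that it sees has new values on all of \<open>ys\<close> and old ones
      elsewhere.\<close>
    have *: "?mix y z = h' z" if "covby P y z \<or> covby P z y" for z
      using that nb[of z] out[of z] irr[of y] h by (cases "z \<in> set ys") auto
    have "down_sum P (?mix y) y = down_sum P h' y"
      using * by (intro down_sum_cong) (auto simp: lowers_def)
    moreover have "up_par P (?mix y) y = up_par P h' y"
      using * by (intro up_par_cong) (auto simp: uppers_def)
    ultimately show ?thesis using True h out[OF y] by simp
  next
    case False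
    then have x: "x \<in> set ys" using Cons.prems by simp
    let ?mix' = "\<lambda>z. if z \<in> set ys \<and> T x z then h' z else f z"
    \<comment> \<open>If the neighbour \<open>z\<close> is \<open>y\<close>, it is toggled after
      \<open>x\<close>; then \<open>T x y\<close> fails and both sides are the old value.\<close>
    have *: "?mix x z = ?mix' z" if "covby P x z \<or> covby P z x" for z
      using that nb[OF x] y h by (auto dest: nb)
    have "down_sum P (?mix x) x = down_sum P ?mix' x"
      using * by (intro down_sum_cong) (auto simp: lowers_def)
    moreover have "up_par P (?mix x) x = up_par P ?mix' x"
      using * by (intro up_par_cong) (auto simp: uppers_def)
    moreover have "h' x = down_sum P ?mix' x * up_par P ?mix' x / f x"
      unfolding h'_def using Cons x by auto
    ultimately show ?thesis using False h by simp
  qed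
  then show ?case by (simp only: h_def)
qed

text \<open>The toggle equation multiplied out, so that the parallel sum becomes a sum of
  reciprocals. \<open>T\<close> marks the neighbours that enter with their new value; rowmotion and
  promotion differ only in \<open>T\<close>.\<close>

definition toggle_sequel :: "nat \<Rightarrow> nat \<Rightarrow> (elt \<Rightarrow> elt \<Rightarrow> bool) \<Rightarrow> (elt \<Rightarrow> real) \<Rightarrow> (elt \<Rightarrow> real) \<Rightarrow> bool" where
  "toggle_sequel a b T f h \<longleftrightarrow> (\<forall>i j. (i, j) \<in> rect a b \<longrightarrow>
     (let mix = (\<lambda>z. if T (i, j) z then h z else f z) in
       h (i, j) * f (i, j) * (upper_inv a b mix (Suc i) j + upper_inv a b mix i (Suc j))
       = lower_val mix (i - 1) j + lower_val mix i (j - 1)))"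

lemma btoggle_pos:
  assumes "\<And>y. y \<in> rect a b \<Longrightarrow> 0 < f y" "x \<in> rect a b" "y \<in> rect a b"
  shows "0 < btoggle (rect a b) x f y"
proof -
  obtain i j where x: "x = (i, j)" by force
  have "0 < down_sum (rect a b) f x" "0 < up_par (rect a b) f x"
    using assms lower_sum_pos[of i j a b f] upper_sum_pos[of i j a b f]
    by (auto simp: x down_sum_rect up_par_rect)
  then show ?thesis using assms by (simp add: btoggle_def)
qed

lemma foldr_btoggle_pos:
  assumes "\<And>y. y \<in> rect a b \<Longrightarrow> 0 < f y" "set L \<subseteq> rect a b" "y \<in> rect a b"
  shows "0 < foldr (btoggle (rect a b)) L f y"
  using assms(2,3)
proof (induction L arbitrary: y)
  case Nil
  then show ?case using assms(1) by simp
next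
  case (Cons x L)
  then show ?case by (auto intro: btoggle_pos)
qed

text \<open>No element is its own neighbour, so toggling \<open>x\<close> keeps both neighbour sums
  at \<open>x\<close>, and \<open>c / (c / f x) = f x\<close>.\<close>

lemma btoggle_btoggle:
  assumes "\<And>y. y \<in> rect a b \<Longrightarrow> 0 < f y" "x \<in> rect a b"
  shows "btoggle (rect a b) x (btoggle (rect a b) x f) = f"
proof -
  obtain i j where x: "x = (i, j)" by force
  let ?P = "rect a b"
  have pos: "0 < down_sum ?P f x" "0 < up_par ?P f x" "0 < f x"
    using assms lower_sum_pos[of i j a b f] upper_sum_pos[of i j a b f]
    by (auto simp: x down_sum_rect up_par_rect)
  have irr: "\<not> covby ?P x x" by (auto simp: covby_def pless_def)
  have "down_sum ?P (btoggle ?P x f) x = down_sum ?P f x"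
    using irr by (intro down_sum_cong) (auto simp: lowers_def btoggle_def)
  moreover have "up_par ?P (btoggle ?P x f) x = up_par ?P f x"
    using irr by (intro up_par_cong) (auto simp: uppers_def btoggle_def)
  ultimately show ?thesis using pos by (auto simp: btoggle_def fun_eq_iff)
qed

text \<open>Toggles are involutions that keep positivity, so a composition is undone toggle by
  toggle from the head of the list. This permits going back in time along promotion orbits.\<close>

lemma foldr_btoggle_surj:
  assumes "\<And>y. y \<in> rect a b \<Longrightarrow> 0 < f y" "set L \<subseteq> rect a b"
  shows "\<exists>g. (\<forall>y\<in>rect a b. 0 < g y) \<and> foldr (btoggle (rect a b)) L g = f"
  using assms
proof (induction L arbitrary: f)
  case Nil
  then show ?case by auto
next
  case (Cons x L)
  have "\<And>y. y \<in> rect a b \<Longrightarrow> 0 < btoggle (rect a b) x f y"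
    using Cons.prems by (auto intro: btoggle_pos)
  then obtain g where "\<forall>y\<in>rect a b. 0 < g y"
    and "foldr (btoggle (rect a b)) L g = btoggle (rect a b) x f"
    using Cons.IH[of "btoggle (rect a b) x f"] Cons.prems by auto
  then show ?case using btoggle_btoggle[of a b f x] Cons.prems by auto
qed

lemma foldr_btoggle_sequel:
  assumes "distinct L" "set L = rect a b" "\<And>y. y \<in> rect a b \<Longrightarrow> 0 < f y"
    and "sorted_wrt (\<lambda>x y. covby (rect a b) x y \<or> covby (rect a b) y x \<longrightarrow> T x y \<and> \<not> T y x) L"
  shows "toggle_sequel a b T f (foldr (btoggle (rect a b)) L f)"
  unfolding toggle_sequel_def Let_def
proof (intro allI impI)
  fix i j
  assume ij: "(i, j) \<in> rect a b"
  let ?P = "rect a b"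
  define h where "h = foldr (btoggle ?P) L f"
  have h_pos: "\<And>y. y \<in> ?P \<Longrightarrow> 0 < h y"
    unfolding h_def using assms(2,3) by (intro foldr_btoggle_pos) auto
  define mix where "mix = (\<lambda>z. if T (i, j) z then h z else f z)"
  have mix_pos: "\<And>y. y \<in> ?P \<Longrightarrow> 0 < mix y"
    using h_pos assms(3) by (auto simp: mix_def)
  define mix' where "mix' = (\<lambda>z. if z \<in> set L \<and> T (i, j) z then h z else f z)"
  have "h (i, j) = down_sum ?P mix' (i, j) * up_par ?P mix' (i, j) / f (i, j)"
    unfolding h_def mix'_def
    by (rule foldr_btoggle_partial) (use assms ij in auto)
  moreover have "down_sum ?P mix' (i, j) = down_sum ?P mix (i, j)"
    by (intro down_sum_cong) (auto simp: lowers_def covby_def mix_def mix'_def assms(2))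
  moreover have "up_par ?P mix' (i, j) = up_par ?P mix (i, j)"
    by (intro up_par_cong) (auto simp: uppers_def covby_def mix_def mix'_def assms(2))
  ultimately have "h (i, j) = down_sum ?P mix (i, j) * up_par ?P mix (i, j) / f (i, j)"
    by simp
  moreover have "0 < upper_inv a b mix (Suc i) j + upper_inv a b mix i (Suc j)"
    using upper_sum_pos[OF ij mix_pos] .
  moreover have "0 < f (i, j)" using assms(3) ij by simp
  ultimately have "h (i, j) * f (i, j) * (upper_inv a b mix (Suc i) j + upper_inv a b mix i (Suc j))
      = lower_val mix (i - 1) j + lower_val mix i (j - 1)"
    by (simp add: down_sum_rect[OF ij] up_par_rect[OF ij])
  then show "foldr (btoggle ?P) L f (i, j) * f (i, j) *
      (upper_inv a b (\<lambda>z. if T (i, j) z then foldr (btoggle ?P) L f z else f z) (Suc i) j +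
       upper_inv a b (\<lambda>z. if T (i, j) z then foldr (btoggle ?P) L f z else f z) i (Suc j))
      = lower_val (\<lambda>z. if T (i, j) z then foldr (btoggle ?P) L f z else f z) (i - 1) j +
        lower_val (\<lambda>z. if T (i, j) z then foldr (btoggle ?P) L f z else f z) i (j - 1)"
    by (simp only: h_def mix_def)
qed

section \<open>Rowmotion and promotion orbits as recurrences\<close>

text \<open>Rowmotion toggles from the top: at its toggle an element sees new values above and old
  values below.\<close>

definition row_orbit :: "nat \<Rightarrow> nat \<Rightarrow> (nat \<Rightarrow> elt \<Rightarrow> real) \<Rightarrow> bool" where
  "row_orbit a b f \<longleftrightarrow> (\<forall>m. \<forall>x\<in>rect a b. 0 < f m x) \<and> (\<forall>m i j. (i, j) \<in> rect a b \<longrightarrow>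
     f (Suc m) (i, j) * f m (i, j) * (upper_inv a b (f (Suc m)) (Suc i) j + upper_inv a b (f (Suc m)) i (Suc j))
     = lower_val (f m) (i - 1) j + lower_val (f m) i (j - 1))"

text \<open>The neighbours \<open>(i + 1, j)\<close> and \<open>(i, j - 1)\<close> lie on the
  previous file and enter with new values, the other two with old ones.\<close>

definition pro_orbit :: "nat \<Rightarrow> nat \<Rightarrow> (nat \<Rightarrow> elt \<Rightarrow> real) \<Rightarrow> bool" where
  "pro_orbit a b g \<longleftrightarrow> (\<forall>m. \<forall>x\<in>rect a b. 0 < g m x) \<and> (\<forall>m i j. (i, j) \<in> rect a b \<longrightarrow>
     g (Suc m) (i, j) * g m (i, j) * (upper_inv a b (g (Suc m)) (Suc i) j + upper_inv a b (g m) i (Suc j))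
     = lower_val (g m) (i - 1) j + lower_val (g (Suc m)) i (j - 1))"

lemma row_orbit_brow:
  assumes L: "linear_extension (rect a b) L" and f: "\<And>x. x \<in> rect a b \<Longrightarrow> 0 < f x"
  shows "row_orbit a b (\<lambda>m. (brow (rect a b) L ^^ m) f)"
proof -
  let ?P = "rect a b"
  define F where "F m = (brow ?P L ^^ m) f" for m
  have Fs: "F (Suc m) = foldr (btoggle ?P) L (F m)" for m
    by (simp add: F_def brow_def)
  have dist: "distinct L" and set: "set L = ?P" using L by (auto simp: linear_extension_def)
  have pos: "0 < F m x" if "x \<in> ?P" for m x
    using that
  proof (induction m arbitrary: x)
    case 0
    then show ?case using f by (simp add: F_def)
  next
    case (Suc m)
    then show ?case unfolding Fs by (intro foldr_btoggle_pos) (auto simp: set)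
  qed
  have srt: "sorted_wrt (\<lambda>x y. covby ?P x y \<or> covby ?P y x \<longrightarrow> pless x y \<and> \<not> pless y x) L"
    using L unfolding linear_extension_def sorted_wrt_iff_nth_less covby_def by blast
  have "F (Suc m) (i, j) * F m (i, j) * (upper_inv a b (F (Suc m)) (Suc i) j + upper_inv a b (F (Suc m)) i (Suc j))
     = lower_val (F m) (i - 1) j + lower_val (F m) i (j - 1)" if ij: "(i, j) \<in> ?P" for m i j
  proof -
    have "toggle_sequel a b pless (F m) (F (Suc m))"
      unfolding Fs by (intro foldr_btoggle_sequel dist set srt pos)
    from this[unfolded toggle_sequel_def Let_def, rule_format, OF ij]
    show ?thesis using ij by (auto simp: upper_inv_def lower_val_def pless_def mem_rect)
  qed
  then show ?thesis using pos unfolding row_orbit_def F_def by blast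
qed

text \<open>Files come in decreasing order because \<open>foldr\<close> toggles from the end of the
  list.\<close>

definition pro_list :: "nat \<Rightarrow> nat \<Rightarrow> elt list" where
  "pro_list a b = concat (map (file_list a b) (rev [1..<a+b]))"

lemma bpro_eq: "bpro a b f = foldr (btoggle (rect a b)) (pro_list a b) f"
proof -
  have "fold (file_toggle a b) ks f = foldr (btoggle (rect a b)) (concat (map (file_list a b) (rev ks))) f" for ks
    by (induction ks arbitrary: f) (simp_all add: file_toggle_def)
  then show ?thesis by (simp add: bpro_def pro_list_def)
qed

lemma rect_list_eq: "rect_list a b = List.product [1..<a+1] [1..<b+1]"
  by (simp add: rect_list_def product_concat_map)

lemma set_rect_list: "set (rect_list a b) = rect a b"
  by (auto simp: rect_list_eq rect_def)

lemma distinct_rect_list: "distinct (rect_list a b)"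
  by (simp add: rect_list_eq distinct_product)

lemma set_file_list: "set (file_list a b k) = {(i, j). (i, j) \<in> rect a b \<and> j + a = k + i}"
  by (auto simp: file_list_def set_rect_list)

lemma set_pro_list: "set (pro_list a b) = rect a b"
proof -
  have "\<exists>k\<in>{1..<a + b}. j + a = k + i" if "(i, j) \<in> rect a b" for i j
    using that by (intro bexI[of _ "j + a - i"]) (auto simp: mem_rect)
  then show ?thesis by (fastforce simp: pro_list_def set_file_list)
qed

lemma distinct_concat_files:
  "distinct ks \<Longrightarrow> distinct (concat (map (file_list a b) ks))"
proof (induction ks)
  case (Cons k ks)
  have "distinct (file_list a b k)"
    by (simp add: file_list_def distinct_rect_list)
  then show ?case using Cons by (auto simp: set_file_list)
qed simp

text \<open>Compares the file indices \<open>j - i + a\<close>, written additively to avoid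
  truncated subtraction.\<close>

definition earlier_file :: "elt \<Rightarrow> elt \<Rightarrow> bool" where
  "earlier_file x z \<longleftrightarrow> snd z + fst x < snd x + fst z"

text \<open>A cover changes the file index by one, so elements of one file are never neighbours and
  only the order of the files matters.\<close>

lemma sorted_concat_files:
  assumes "sorted_wrt (>) ks"
  shows "sorted_wrt (\<lambda>x y. covby (rect a b) x y \<or> covby (rect a b) y x \<longrightarrow>
    earlier_file x y \<and> \<not> earlier_file y x) (concat (map (file_list a b) ks))" (is "sorted_wrt ?R _")
  using assms
proof (induction ks)
  case (Cons k ks)
  have same: "?R x y" if "x \<in> set (file_list a b k)" "y \<in> set (file_list a b k)" for x y
    using that unfolding set_file_list by (auto simp: covby_rect)
  have "sorted_wrt ?R (file_list a b k)"
    by (rule sorted_wrt_mono_rel[of _ "\<lambda>_ _. True", OF same]) simp_all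
  moreover have "?R x y" if "x \<in> set (file_list a b k)" "y \<in> set (file_list a b k')" "k' < k" for x y k'
    using that unfolding set_file_list by (auto simp: covby_rect earlier_file_def)
  ultimately show ?case using Cons by (auto simp: sorted_wrt_append)
qed simp

lemma pro_orbit_bpro:
  assumes f: "\<And>x. x \<in> rect a b \<Longrightarrow> 0 < f x"
  shows "pro_orbit a b (\<lambda>m. (bpro a b ^^ m) f)"
proof -
  let ?P = "rect a b" and ?L = "pro_list a b"
  define F where "F m = (bpro a b ^^ m) f" for m
  have Fs: "F (Suc m) = foldr (btoggle ?P) ?L (F m)" for m
    by (simp add: F_def bpro_eq)
  have pos: "0 < F m x" if "x \<in> ?P" for m x
    using that
  proof (induction m arbitrary: x)
    case 0
    then show ?case using f by (simp add: F_def)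
  next
    case (Suc m)
    then show ?case unfolding Fs by (intro foldr_btoggle_pos) (auto simp: set_pro_list)
  qed
  have dist: "distinct ?L" unfolding pro_list_def by (rule distinct_concat_files) simp
  have "sorted_wrt (>) (rev [1..<a+b])" by (simp add: sorted_wrt_rev)
  then have srt: "sorted_wrt (\<lambda>x y. covby ?P x y \<or> covby ?P y x \<longrightarrow>
      earlier_file x y \<and> \<not> earlier_file y x) ?L"
    unfolding pro_list_def by (rule sorted_concat_files)
  have "F (Suc m) (i, j) * F m (i, j) * (upper_inv a b (F (Suc m)) (Suc i) j + upper_inv a b (F m) i (Suc j))
     = lower_val (F m) (i - 1) j + lower_val (F (Suc m)) i (j - 1)" if ij: "(i, j) \<in> ?P" for m i j
  proof -
    have "toggle_sequel a b earlier_file (F m) (F (Suc m))"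
      unfolding Fs by (intro foldr_btoggle_sequel dist set_pro_list srt pos)
    from this[unfolded toggle_sequel_def Let_def, rule_format, OF ij]
    show ?thesis using ij by (auto simp: upper_inv_def lower_val_def earlier_file_def mem_rect)
  qed
  then show ?thesis using pos unfolding pro_orbit_def F_def by blast
qed

lemma bpro_surj:
  assumes "\<And>x. x \<in> rect a b \<Longrightarrow> 0 < f x"
  shows "\<exists>g. (\<forall>x\<in>rect a b. 0 < g x) \<and> (bpro a b ^^ m) g = f"
  using assms
proof (induction m arbitrary: f)
  case 0
  then show ?case by auto
next
  case (Suc m)
  obtain g where g: "\<forall>x\<in>rect a b. 0 < g x" "bpro a b g = f"
    using foldr_btoggle_surj[of a b f "pro_list a b"] Suc.prems
    by (auto simp: bpro_eq set_pro_list)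
  then obtain g' where "\<forall>x\<in>rect a b. 0 < g' x" "(bpro a b ^^ m) g' = g"
    using Suc.IH[of g] by auto
  then show ?case using g by (intro exI[of _ g']) auto
qed

section \<open>Weighted path sums\<close>

text \<open>Weighted sums over paths with steps $(1,0)$ and $(0,1)$: \<^term>\<open>down_path W i r j\<close> runs over
  those from $(i,1)$ to $(r,j)$, and \<^term>\<open>up_path a b W k r j\<close> over those from $(r,j)$ to $(k,b)$.\<close>

fun down_path :: "(elt \<Rightarrow> real) \<Rightarrow> nat \<Rightarrow> nat \<Rightarrow> nat \<Rightarrow> real" where
  "down_path W i 0 j = 0"
| "down_path W i (Suc r) 0 = (if Suc r = i then 1 else 0)"
| "down_path W i (Suc r) (Suc j) = W (Suc r, Suc j) * (down_path W i r (Suc j) + down_path W i (Suc r) j)"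

text \<open>A half turn of the rectangle exchanges the two directions, so facts on
  \<open>down_path\<close> carry over.\<close>

definition up_path :: "nat \<Rightarrow> nat \<Rightarrow> (elt \<Rightarrow> real) \<Rightarrow> nat \<Rightarrow> nat \<Rightarrow> nat \<Rightarrow> real" where
  "up_path a b W k r j = down_path (\<lambda>(r, j). W (a + 1 - r, b + 1 - j)) (a + 1 - k) (a + 1 - r) (b + 1 - j)"

lemma down_path_rec:
  "(r, j) \<in> rect a b \<Longrightarrow> down_path W i r j = W (r, j) * (down_path W i (r - 1) j + down_path W i r (j - 1))"
  by (cases r; cases j) (simp_all add: mem_rect)

lemma up_path_rec:
  assumes "(r, j) \<in> rect a b"
  shows "up_path a b W k r j = W (r, j) * (up_path a b W k (Suc r) j + up_path a b W k r (Suc j))"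
proof -
  have "a + 1 - r = Suc (a - r)" "b + 1 - j = Suc (b - j)"
    and "a + 1 - (a + 1 - r) = r" "b + 1 - (b + 1 - j) = j"
    using assms by (auto simp: mem_rect)
  then show ?thesis by (simp add: up_path_def)
qed

lemma up_path_top [simp]: "up_path a b W k (Suc a) j = 0"
  by (simp add: up_path_def)

lemma up_path_right: "1 \<le> r \<Longrightarrow> r \<le> a \<Longrightarrow> k \<le> a \<Longrightarrow> up_path a b W k r (Suc b) = (if r = k then 1 else 0)"
  by (cases "a + 1 - r") (auto simp: up_path_def)

lemma down_path_start: "1 \<le> r \<Longrightarrow> down_path W i r 0 = (if r = i then 1 else 0)"
  by (cases r) auto

text \<open>Both sides are the total weight of the paths from \<open>(i, 1)\<close> to
  \<open>(k, b)\<close>, built up from opposite ends.\<close>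

lemma down_path_eq_up_path:
  assumes "1 \<le> i" "i \<le> a" "1 \<le> k" "k \<le> a"
  shows "down_path W i k b = up_path a b W k i 1"
proof -
  let ?D = "down_path W i" and ?U = "up_path a b W k"
  \<comment> \<open>Splitting each path at its step from column $j$ to column $j+1$ gives $T_j$.\<close>
  define T where "T j = (\<Sum>r\<in>{1..a}. ?D r j * ?U r (Suc j))" for j
  have step: "T j = T (Suc j)" if "j < b" for j
  proof -
    let ?g = "\<lambda>r. - (?D r (Suc j) * ?U (Suc r) (Suc j))"
    have "T (Suc j) - T j = (\<Sum>r\<in>{Suc 0..a}. ?D (r - 1) (Suc j) * ?U r (Suc j) - ?D r (Suc j) * ?U (Suc r) (Suc j))"
      unfolding T_def sum_subtractf[symmetric]
    proof (rule sum.cong)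
      fix r
      assume "r \<in> {Suc 0..a}"
      then have rj: "(r, Suc j) \<in> rect a b" using that by (auto simp: mem_rect)
      have "?D r (Suc j) = W (r, Suc j) * (?D (r - 1) (Suc j) + ?D r j)"
        using down_path_rec[OF rj] by simp
      moreover have "?U r (Suc j) = W (r, Suc j) * (?U (Suc r) (Suc j) + ?U r (Suc (Suc j)))"
        by (rule up_path_rec[OF rj])
      \<comment> \<open>Either side is \<open>W (r, Suc j)\<close> times the product of the two
        brackets.\<close>
      ultimately have "?D r (Suc j) * (?U (Suc r) (Suc j) + ?U r (Suc (Suc j))) =
          (?D (r - 1) (Suc j) + ?D r j) * ?U r (Suc j)"
        by (simp only: mult.assoc mult.left_commute mult.commute)
      then show "?D r (Suc j) * ?U r (Suc (Suc j)) - ?D r j * ?U r (Suc j) =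
          ?D (r - 1) (Suc j) * ?U r (Suc j) - ?D r (Suc j) * ?U (Suc r) (Suc j)"
        by (simp add: algebra_simps)
    qed simp
    also have "\<dots> = (\<Sum>r\<in>{Suc 0..a}. ?g r - ?g (r - 1))"
      by (rule sum.cong) auto
    also have "\<dots> = ?g a - ?g 0"
      by (rule sum_telescope'') simp
    \<comment> \<open>No path enters row 0 or row \<open>a + 1\<close>.\<close>
    also have "\<dots> = 0" by simp
    finally show ?thesis by simp
  qed
  have "T j = T 0" if "j \<le> b" for j
    using that
  proof (induction j)
    case (Suc j)
    then show ?case using step[of j] by simp
  qed simp
  from this[of b] have "T b = T 0" by simp
  moreover have "T b = (\<Sum>r\<in>{1..a}. if r = k then ?D r b else 0)"
    unfolding T_def using assms by (intro sum.cong) (auto simp: up_path_right)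
  moreover have "T 0 = (\<Sum>r\<in>{1..a}. if r = i then ?U r 1 else 0)"
    unfolding T_def using assms by (intro sum.cong) (auto simp: down_path_start)
  ultimately show ?thesis using assms by simp
qed

section \<open>Conversion of path sums\<close>

text \<open>In a unit square, \<open>w\<close> is the lower corner, \<open>v\<close> the upper one,
  and \<open>a\<close>, \<open>b\<close> are the other two. \<open>dv\<close> is the mean with
  weights \<open>p\<close>, \<open>q\<close>, and \<open>ew\<close> the mean with weights
  \<open>1/p\<close>, \<open>1/q\<close>, that is, \<open>q\<close>, \<open>p\<close> up to scale.
  This swap makes \<open>(dv - da) * ea - (dv - db) * eb\<close> equal to
  \<open>(db - da) * ew\<close>.\<close>

lemma harmonic_square:
  fixes p q :: real
  assumes "0 < p" "0 < q"
    and d: "dv * (p + q) = p * da + q * db"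
    and e: "ew * (1 / p + 1 / q) = ea / p + eb / q"
  shows "(db - dw) * ew - (dv - da) * ea = (da - dw) * ew - (dv - db) * eb"
proof -
  have dv: "dv - da = q * (db - da) / (p + q)" "dv - db = p * (da - db) / (p + q)"
    using assms by (simp_all add: field_simps)
  have ew: "ew = (q * ea + p * eb) / (p + q)"
    using assms by (simp add: field_simps)
  have "(dv - da) * ea - (dv - db) * eb = (db - da) * ew"
    unfolding dv ew by (simp add: algebra_simps diff_divide_distrib add_divide_distrib)
  then show ?thesis by (simp add: left_diff_distrib)
qed

definition down_ratio :: "(elt \<Rightarrow> real) \<Rightarrow> elt \<Rightarrow> real" where
  "down_ratio f = (\<lambda>(r, j). f (r, j) / (lower_val f (r - 1) j + lower_val f r (j - 1)))"

definition up_ratio :: "nat \<Rightarrow> nat \<Rightarrow> (elt \<Rightarrow> real) \<Rightarrow> elt \<Rightarrow> real" where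
  "up_ratio a b f = (\<lambda>(r, j). 1 / (f (r, j) * (upper_inv a b f (Suc r) j + upper_inv a b f r (Suc j))))"

text \<open>Dividing the first path sum by \<open>f\<close> and multiplying the second by
  \<open>f\<close> gives functions \<open>d\<close> and \<open>e\<close>, weighted means of their
  lower and upper neighbours. Pairing row differences of \<open>d\<close> with \<open>e\<close>
  gives the same number \<open>C\<close> in each column; the last column yields the left side, the
  first column the right side.\<close>

lemma path_conversion:
  assumes f: "\<And>x. x \<in> rect a b \<Longrightarrow> 0 < f x"
    and "1 \<le> i" "i < a" "1 \<le> k" "k < a" "1 \<le> b"
  shows "down_path (down_ratio f) (Suc i) (Suc k) b = up_path a b (up_ratio a b f) k i 1"
proof -
  let ?D = "down_path (down_ratio f) (Suc i)" and ?U = "up_path a b (up_ratio a b f) k"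
  define d where "d r j = ?D r j / f (r, j)" for r j
  define e where "e r j = ?U r j * f (r, j)" for r j
  have d_rec: "d r j * (lower_val f (r - 1) j + lower_val f r (j - 1)) = ?D (r - 1) j + ?D r (j - 1)"
    if rj: "(r, j) \<in> rect a b" for r j
  proof -
    have "0 < lower_val f (r - 1) j + lower_val f r (j - 1)" using lower_sum_pos[OF rj] f by blast
    moreover have "0 < f (r, j)" using f rj by blast
    ultimately show ?thesis unfolding d_def down_path_rec[OF rj] by (simp add: down_ratio_def)
  qed
  have e_rec: "e r j * (upper_inv a b f (Suc r) j + upper_inv a b f r (Suc j)) = ?U (Suc r) j + ?U r (Suc j)"
    if rj: "(r, j) \<in> rect a b" for r j
  proof -
    have "0 < upper_inv a b f (Suc r) j + upper_inv a b f r (Suc j)" using upper_sum_pos[OF rj] f by blast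
    moreover have "0 < f (r, j)" using f rj by blast
    ultimately show ?thesis unfolding e_def up_path_rec[OF rj] by (simp add: up_ratio_def)
  qed
  have fD: "?D r j = d r j * f (r, j)" and fU: "?U r j = e r j / f (r, j)"
    if "(r, j) \<in> rect a b" for r j
    using f[OF that] by (simp_all add: d_def e_def)

  \<comment> \<open>Paths start in row \<open>i + 1 > 1\<close> and never descend, so none visits
    row 1; likewise none leads from row \<open>a\<close> to row \<open>k < a\<close>. These zeros
    kill the boundary terms of the telescoping sums.\<close>
  have d_bottom: "d (Suc 0) (Suc j) = 0" if "j < b" for j
  proof -
    have "?D (Suc 0) j = 0" for j using assms(2) by (induction j) auto
    then show ?thesis by (simp add: d_def)
  qed
  have e_top: "e a j = 0" if "1 \<le> j" "j \<le> Suc b" for j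
  proof -
    have "?U a (Suc b - l) = 0" if "l \<le> b" for l
      using that
    proof (induction l)
      case 0
      then show ?case using assms by (simp add: up_path_right)
    next
      case (Suc l)
      then have *: "(a, Suc b - Suc l) \<in> rect a b" and "Suc (Suc b - Suc l) = Suc b - l"
        using assms by (auto simp: mem_rect)
      then show ?case using Suc up_path_rec[OF *] by simp
    qed
    from this[of "Suc b - j"] show ?thesis using that by (simp add: e_def)
  qed
  \<comment> \<open>In column 1, above row 1, the only lower summand is the one in the row below, so
    \<open>d\<close> is constant but for the jump where the paths enter, at row
    \<open>i + 1\<close>.\<close>
  have d_left: "d (Suc r) 1 - d r 1 = (if r = i then 1 / f (r, 1) else 0)" if "1 \<le> r" "r < a" for r
  proof -
    have rj: "(Suc r, 1) \<in> rect a b" "(r, 1) \<in> rect a b" using that assms by (auto simp: mem_rect)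
    have "d (Suc r) 1 * f (r, 1) = ?D r 1 + (if r = i then 1 else 0)"
      using d_rec[OF rj(1)] that by (simp add: lower_val_def)
    then show ?thesis using fD[OF rj(2)] f[OF rj(2)] by (auto simp: field_simps)
  qed
  have e_right: "e r b - e (Suc r) b = (if r = k then f (Suc r, b) else 0)" if "1 \<le> r" "r < a" for r
  proof -
    have rj: "(Suc r, b) \<in> rect a b" "(r, b) \<in> rect a b" using that assms by (auto simp: mem_rect)
    have "e r b / f (Suc r, b) = ?U (Suc r) b + (if r = k then 1 else 0)"
      using e_rec[OF rj(2)] that assms by (simp add: upper_inv_def up_path_right)
    then show ?thesis using fU[OF rj(1)] f[OF rj(1)] by (auto simp: field_simps)
  qed

  \<comment> \<open>\<open>d\<close> and \<open>e\<close> are discrete harmonic on squares, so this sum does not depend on the column.\<close>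
  define C where "C j = (\<Sum>r\<in>{1..<a}. (d (Suc r) j - d r j) * e r j)" for j
  have step: "C j = C (Suc j)" if "1 \<le> j" "j < b" for j
  proof -
    let ?q = "\<lambda>r. (d r (Suc j) - d r j) * e r j"
    have "C j - C (Suc j) = (\<Sum>r\<in>{1..<a}. ?q r - ?q (Suc r))"
      unfolding C_def sum_subtractf[symmetric]
    proof (rule sum.cong)
      fix r
      assume r: "r \<in> {1..<a}"
      have R: "(r, j) \<in> rect a b" "(Suc r, j) \<in> rect a b" "(r, Suc j) \<in> rect a b" "(Suc r, Suc j) \<in> rect a b"
        using r that by (auto simp: mem_rect)
      have "d (Suc r) (Suc j) * (f (r, Suc j) + f (Suc r, j)) =
          f (r, Suc j) * d r (Suc j) + f (Suc r, j) * d (Suc r) j"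
        using d_rec[OF R(4)] fD[OF R(2)] fD[OF R(3)] r that by (simp add: lower_val_def algebra_simps)
      moreover have "e r j * (1 / f (r, Suc j) + 1 / f (Suc r, j)) =
          e r (Suc j) / f (r, Suc j) + e (Suc r) j / f (Suc r, j)"
        using e_rec[OF R(1)] fU[OF R(2)] fU[OF R(3)] r that by (simp add: upper_inv_def algebra_simps)
      ultimately show "(d (Suc r) j - d r j) * e r j - (d (Suc r) (Suc j) - d r (Suc j)) * e r (Suc j)
          = ?q r - ?q (Suc r)"
        by (rule harmonic_square[OF f[OF R(3)] f[OF R(2)]])
    qed simp
    also have "\<dots> = ?q 1 - ?q a"
      using sum_Suc_diff'[of 1 a ?q] assms by (simp add: sum_subtractf)
    also have "\<dots> = 0"
      using d_bottom[of j] d_bottom[of "j - 1"] e_top[of j] that by simp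
    finally show ?thesis by simp
  qed
  have "C (Suc j) = C 1" if "j < b" for j
    using that
  proof (induction j)
    case (Suc j)
    then show ?case using step[of "Suc j"] by simp
  qed simp
  from this[of "b - 1"] have "C b = C 1" using assms by simp
  moreover have "C 1 = (\<Sum>r\<in>{1..<a}. if r = i then e r 1 / f (r, 1) else 0)"
    unfolding C_def
  proof (rule sum.cong)
    fix r
    assume "r \<in> {1..<a}"
    then have *: "d (Suc r) 1 - d r 1 = (if r = i then 1 / f (r, 1) else 0)"
      using d_left[of r] by simp
    show "(d (Suc r) 1 - d r 1) * e r 1 = (if r = i then e r 1 / f (r, 1) else 0)"
      unfolding * by simp
  qed simp
  moreover have "C b = f (Suc k, b) * d (Suc k) b"
  proof -
    have "d 1 b = 0" using d_bottom[of "b - 1"] assms by simp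
    \<comment> \<open>Summation by parts: replacing \<open>e r b\<close> by
      \<open>e (Suc r) b\<close> plus its jump leaves a telescoping difference of
      \<open>d * e\<close>.\<close>
    have "C b = (\<Sum>r\<in>{1..<a}. (d (Suc r) b * e (Suc r) b - d r b * e r b) + (if r = k then f (Suc k, b) * d (Suc k) b else 0))"
      unfolding C_def
    proof (rule sum.cong)
      fix r
      assume "r \<in> {1..<a}"
      then have "e r b = e (Suc r) b + (if r = k then f (Suc r, b) else 0)"
        using e_right[of r] by simp
      then show "(d (Suc r) b - d r b) * e r b =
          (d (Suc r) b * e (Suc r) b - d r b * e r b) + (if r = k then f (Suc k, b) * d (Suc k) b else 0)"
        by (auto simp: algebra_simps)
    qed simp
    also have "\<dots> = (d a b * e a b - d 1 b * e 1 b) + f (Suc k, b) * d (Suc k) b"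
      using assms sum_Suc_diff'[of 1 a "\<lambda>r. d r b * e r b"] by (simp add: sum.distrib)
    finally show ?thesis using \<open>d 1 b = 0\<close> e_top[of b] assms by simp
  qed
  moreover have "(i, 1) \<in> rect a b" "(Suc k, b) \<in> rect a b" using assms by (auto simp: mem_rect)
  ultimately show ?thesis using assms fD[of "Suc k" b] fU[of i 1] by (simp add: mult.commute)
qed

section \<open>Reciprocity and periodicity of rowmotion\<close>

lemma row_orbit_pos: "row_orbit a b f \<Longrightarrow> x \<in> rect a b \<Longrightarrow> 0 < f m x"
  by (simp add: row_orbit_def)

lemma row_orbit_step:
  "row_orbit a b f \<Longrightarrow> (i, j) \<in> rect a b \<Longrightarrow>
     f (Suc m) (i, j) * f m (i, j) * (upper_inv a b (f (Suc m)) (Suc i) j + upper_inv a b (f (Suc m)) i (Suc j))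
     = lower_val (f m) (i - 1) j + lower_val (f m) i (j - 1)"
  by (simp add: row_orbit_def)

text \<open>This is the rowmotion recurrence with its factors sorted by time; it lets the same
  weights serve both kinds of path sums.\<close>

lemma up_ratio_row_orbit:
  assumes "row_orbit a b f" "x \<in> rect a b"
  shows "up_ratio a b (f (Suc m)) x = down_ratio (f m) x"
proof -
  obtain i j where x: "x = (i, j)" by force
  with assms have ij: "(i, j) \<in> rect a b" by simp
  let ?h = "upper_inv a b (f (Suc m)) (Suc i) j + upper_inv a b (f (Suc m)) i (Suc j)"
  let ?l = "lower_val (f m) (i - 1) j + lower_val (f m) i (j - 1)"
  have "0 < ?h" "0 < ?l" "0 < f m (i, j)" "0 < f (Suc m) (i, j)"
    using upper_sum_pos[OF ij] lower_sum_pos[OF ij] row_orbit_pos[OF assms(1)] ij by blast+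
  with row_orbit_step[OF assms(1) ij, of m] show ?thesis
    by (simp add: x up_ratio_def down_ratio_def divide_simps) (simp add: mult.commute mult.left_commute)
qed

lemma down_path_cong:
  assumes "\<And>x. x \<in> rect a b \<Longrightarrow> W x = W' x"
  shows "r \<le> a \<Longrightarrow> j \<le> b \<Longrightarrow> down_path W i r j = down_path W' i r j"
proof (induction r arbitrary: j)
  case (Suc r)
  show ?case
    using Suc.prems(2) by (induction j) (use Suc assms in \<open>simp_all add: mem_rect\<close>)
qed simp

lemma up_path_cong:
  assumes "\<And>x. x \<in> rect a b \<Longrightarrow> W x = W' x" "1 \<le> r" "1 \<le> j"
  shows "up_path a b W k r j = up_path a b W' k r j"
  unfolding up_path_def
  by (rule down_path_cong[where a = a and b = b])
    (use assms(2,3) in \<open>auto simp: mem_rect intro!: assms(1)\<close>)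

text \<open>The definition of \<open>down_ratio\<close> solved for \<open>f\<close> is the path
  recurrence; the paths enter in row 1, next to the bottom element.\<close>

lemma lower_eq_down_path:
  assumes f: "\<And>x. x \<in> rect a b \<Longrightarrow> 0 < f x"
  shows "r \<le> a \<Longrightarrow> j \<le> b \<Longrightarrow> lower_val f r j = down_path (down_ratio f) 1 r j"
proof (induction "down_ratio f" "1::nat" r j rule: down_path.induct)
  case (3 r j)
  then have rj: "(Suc r, Suc j) \<in> rect a b" by (simp add: mem_rect)
  have "0 < lower_val f r (Suc j) + lower_val f (Suc r) j" using lower_sum_pos[OF rj] f by simp
  with 3 show ?case by (simp add: down_ratio_def) (simp add: lower_val_def)
qed (auto simp: lower_val_def)

text \<open>The dual statement: paths leave in row \<open>a\<close>, next to the top element, and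
  the induction is on the distance to that corner.\<close>

lemma upper_inv_eq_up_path:
  assumes f: "\<And>x. x \<in> rect a b \<Longrightarrow> 0 < f x"
    and "1 \<le> r" "r \<le> Suc a" "1 \<le> j" "j \<le> Suc b"
  shows "upper_inv a b f r j = up_path a b (up_ratio a b f) a r j"
  using assms(2-)
proof (induction "(Suc a - r) + (Suc b - j)" arbitrary: r j rule: less_induct)
  case less
  show ?case
  proof (cases "r = Suc a \<or> j = Suc b")
    case True
    then show ?thesis using less.prems by (cases "r = Suc a") (auto simp: upper_inv_def up_path_right)
  next
    case False
    with less.prems have rj: "(r, j) \<in> rect a b" by (auto simp: mem_rect)
    have "upper_inv a b f (Suc r) j = up_path a b (up_ratio a b f) a (Suc r) j"
      "upper_inv a b f r (Suc j) = up_path a b (up_ratio a b f) a r (Suc j)"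
      using less False by auto
    moreover have "0 < upper_inv a b f (Suc r) j + upper_inv a b f r (Suc j)" "0 < f (r, j)"
      using upper_sum_pos[OF rj] f rj by auto
    moreover have "upper_inv a b f r j = 1 / f (r, j)" using rj by (simp add: upper_inv_def mem_rect)
    ultimately show ?thesis
      unfolding up_path_rec[OF rj] by (simp add: up_ratio_def)
  qed
qed

text \<open>Each unit of \<open>s\<close> is one conversion, which shifts both ends by a row; the
  recurrence then turns \<open>up_ratio\<close> at time \<open>m + s + 1\<close> into
  \<open>down_ratio\<close> at time \<open>m + s\<close>.\<close>

lemma down_path_shift:
  assumes f: "row_orbit a b f" and "1 \<le> i" "i + s \<le> a" "1 \<le> k" "k + s \<le> a" "1 \<le> b"
  shows "down_path (down_ratio (f (m + s))) (i + s) (k + s) b = down_path (down_ratio (f m)) i k b"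
  using assms(2-)
proof (induction s)
  case (Suc s)
  note pos = row_orbit_pos[OF f]
  have "down_path (down_ratio (f (Suc (m + s)))) (Suc (i + s)) (Suc (k + s)) b =
      up_path a b (up_ratio a b (f (Suc (m + s)))) (k + s) (i + s) 1"
    using Suc.prems by (intro path_conversion pos) auto
  also have "\<dots> = up_path a b (down_ratio (f (m + s))) (k + s) (i + s) 1"
    using Suc.prems by (intro up_path_cong up_ratio_row_orbit f) auto
  also have "\<dots> = down_path (down_ratio (f (m + s))) (i + s) (k + s) b"
  by (rule down_path_eq_up_path[symmetric]) (use Suc.prems in auto)
  finally show ?case using Suc by simp
qed simp

text \<open>\<open>f m (a + 1 - i, b)\<close> is a path sum starting in row 1. A shift by
  \<open>i - 1\<close> rows moves its end to row \<open>a\<close>, and there the sum read from its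
  start \<open>(i, 1)\<close> is \<open>1 / f (m + i) (i, 1)\<close>.\<close>

lemma reciprocity_left:
  assumes f: "row_orbit a b f" and i: "1 \<le> i" "i \<le> a" and b: "1 \<le> b"
  shows "f (m + i) (i, 1) * f m (a + 1 - i, b) = 1"
proof -
  note pos = row_orbit_pos[OF f]
  have "f m (a + 1 - i, b) = down_path (down_ratio (f m)) 1 (a + 1 - i) b"
    using lower_eq_down_path[of a b "f m" "a + 1 - i" b, OF pos] i b by (simp add: lower_val_def)
  also have "\<dots> = down_path (down_ratio (f (m + (i - 1)))) i a b"
    using down_path_shift[OF f, of 1 "i - 1" "a + 1 - i" m] i b by simp
  also have "\<dots> = up_path a b (down_ratio (f (m + (i - 1)))) a i 1"
  by (rule down_path_eq_up_path) (use i in auto)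
  also have "\<dots> = up_path a b (up_ratio a b (f (Suc (m + (i - 1))))) a i 1"
    using i by (intro up_path_cong up_ratio_row_orbit[symmetric] f) auto
  also have "\<dots> = upper_inv a b (f (Suc (m + (i - 1)))) i 1"
    using i b by (intro upper_inv_eq_up_path[symmetric] pos) auto
  also have "\<dots> = 1 / f (m + i) (i, 1)" using i b by (simp add: upper_inv_def)
  finally show ?thesis using pos[of "(i, 1)" "m + i"] i b by (simp add: mem_rect)
qed

lemma reciprocity:
  assumes f: "row_orbit a b f" and "(i, j) \<in> rect a b"
  shows "f (m + i + j - 1) (i, j) * f m (a + 1 - i, b + 1 - j) = 1"
  using assms(2)
proof (induction j arbitrary: i m rule: less_induct)
  case (less j)
  then have i: "1 \<le> i" "i \<le> a" and j: "1 \<le> j" "j \<le> b" by (auto simp: mem_rect)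
  show ?case
  proof (cases "j = 1")
    case True
    then show ?thesis using reciprocity_left[OF f i, of m] j by simp
  next
    case False
    then obtain l where jl: "j = Suc l" and l: "1 \<le> l" "l < b"
      using j by (cases j) auto
    \<comment> \<open>The recurrences at \<open>(i, l)\<close>, time \<open>M\<close>, and at its antipode \<open>(I, J)\<close>, time \<open>m\<close>, match by
      induction in all terms but one.\<close>
    define I J M where "I = a + 1 - i" and "J = b + 1 - l" and "M = m + i + l - 1"
    have IJ: "(I, J) \<in> rect a b" and il: "(i, l) \<in> rect a b"
      using i l by (auto simp: I_def J_def mem_rect)
    have pos: "x \<in> rect a b \<Longrightarrow> f t x \<noteq> 0" for t x
      using row_orbit_pos[OF f, of x t] by simp
    have IH: "f (t + r + s - 1) (r, s) = 1 / f t (a + 1 - r, b + 1 - s)"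
      if "1 \<le> r" "r \<le> a" "1 \<le> s" "s \<le> l" for t r s
      using less.IH[of s r t] that jl l
      by (auto simp: mem_rect intro!: eq_divide_imp)
    have inv: "f M (i, l) = 1 / f m (I, J)" "f (Suc M) (i, l) = 1 / f (Suc m) (I, J)"
      using IH[of i l m] IH[of i l "Suc m"] i l by (simp_all add: I_def J_def M_def)
    \<comment> \<open>The boundary conventions match too: the antipode of the bottom element is the
      top element, and zeros face zeros.\<close>
    have hi_lo: "upper_inv a b (f (Suc M)) (Suc i) l = lower_val (f m) (I - 1) J"
      using IH[of "Suc i" l m] i l by (auto simp: upper_inv_def lower_val_def I_def J_def M_def)
    have lo_hi: "lower_val (f M) (i - 1) l = upper_inv a b (f (Suc m)) (Suc I) J"
      using IH[of "i - 1" l "Suc m"] i l by (auto simp: upper_inv_def lower_val_def I_def J_def M_def Suc_diff_le)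
    have lo_hi': "lower_val (f M) i (l - 1) = upper_inv a b (f (Suc m)) I (Suc J)"
      using IH[of i "l - 1" "Suc m"] i l by (auto simp: upper_inv_def lower_val_def I_def J_def M_def Suc_diff_le)
    have "lower_val (f m) (I - 1) J + lower_val (f m) I (J - 1) =
        f (Suc m) (I, J) * f m (I, J) * (lower_val (f M) (i - 1) l + lower_val (f M) i (l - 1))"
      using row_orbit_step[OF f IJ, of m] by (simp only: lo_hi lo_hi')
    also have "\<dots> = f (Suc m) (I, J) * f m (I, J) * (1 / f (Suc m) (I, J) * (1 / f m (I, J)) *
        (lower_val (f m) (I - 1) J + upper_inv a b (f (Suc M)) i (Suc l)))"
      unfolding row_orbit_step[OF f il, of M, symmetric] inv hi_lo ..
    also have "\<dots> = lower_val (f m) (I - 1) J + upper_inv a b (f (Suc M)) i (Suc l)"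
      using pos[OF IJ] by simp
    finally have "upper_inv a b (f (Suc M)) i (Suc l) = lower_val (f m) I (J - 1)"
      by simp
    moreover have "upper_inv a b (f (Suc M)) i (Suc l) = 1 / f (Suc M) (i, j)"
      using i l by (simp add: upper_inv_def jl)
    moreover have "lower_val (f m) I (J - 1) = f m (I, J - 1)"
      using i l by (simp add: lower_val_def I_def J_def)
    ultimately have "f (Suc M) (i, j) * f m (I, J - 1) = 1"
      using pos[OF less.prems] by (metis nonzero_eq_divide_eq mult.commute)
    moreover have "Suc M = m + i + j - 1" "J - 1 = b + 1 - j"
      using i l by (simp_all add: M_def J_def jl)
    ultimately show ?thesis by (simp only: I_def)
  qed
qed

text \<open>Reciprocity applied at \<open>x\<close> and at its antipode returns to \<open>x\<close>;
  the two time lags add up to \<open>a + b\<close>.\<close>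

lemma row_orbit_periodic:
  assumes f: "row_orbit a b f" and x: "x \<in> rect a b"
  shows "f (m + (a + b)) x = f m x"
proof -
  obtain i j where ij: "x = (i, j)" by force
  with x have 1: "1 \<le> i" "i \<le> a" "1 \<le> j" "j \<le> b" by (auto simp: mem_rect)
  let ?i = "a + 1 - i" and ?j = "b + 1 - j"
  let ?m = "m + ?i + ?j - 1"
  have "f ?m (?i, ?j) * f m (a + 1 - ?i, b + 1 - ?j) = 1"
    using 1 by (intro reciprocity[OF f]) (auto simp: mem_rect)
  moreover have "a + 1 - ?i = i" "b + 1 - ?j = j" using 1 by auto
  ultimately have one: "f ?m (?i, ?j) * f m (i, j) = 1" by simp
  have "f (?m + i + j - 1) (i, j) * f ?m (?i, ?j) = 1"
    using 1 by (intro reciprocity[OF f]) (auto simp: mem_rect)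
  moreover have "?m + i + j - 1 = m + (a + b)" using 1 by auto
  ultimately have "f (m + (a + b)) (i, j) * f ?m (?i, ?j) = f m (i, j) * f ?m (?i, ?j)"
    using one by (simp only: mult.commute)
  moreover have "f ?m (?i, ?j) \<noteq> 0" using one by auto
  ultimately show ?thesis unfolding ij by simp
qed

lemma sum_periodic_shift:
  fixes h :: "nat \<Rightarrow> real"
  assumes "\<And>m. h (m + n) = h m"
  shows "(\<Sum>m<n. h (m + s)) = (\<Sum>m<n. h m)"
proof (induction s)
  case (Suc s)
  have "(\<Sum>m<n. h (Suc m + s)) = (\<Sum>m<n. h (m + s))"
    using sum.lessThan_Suc_shift[of "\<lambda>m. h (m + s)" n] assms[of s] by (simp add: add.commute)
  then show ?case using Suc by simp
qed simp

lemma row_orbit_antipodal_sum: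
  assumes f: "row_orbit a b f" and ij: "(i, j) \<in> rect a b"
  shows "(\<Sum>m<a+b. ln (f m (i, j))) + (\<Sum>m<a+b. ln (f m (a + 1 - i, b + 1 - j))) = 0"
proof -
  \<comment> \<open>The shift is the time lag in reciprocity.\<close>
  have "(\<Sum>m<a+b. ln (f m (i, j))) = (\<Sum>m<a+b. ln (f (m + (i + j - 1)) (i, j)))"
    by (rule sum_periodic_shift[symmetric]) (simp add: row_orbit_periodic[OF f ij])
  also have "\<dots> = (\<Sum>m<a+b. - ln (f m (a + 1 - i, b + 1 - j)))"
  proof (rule sum.cong)
    fix m
    have "m + (i + j - 1) = m + i + j - 1" using ij by (simp add: mem_rect)
    moreover have "f (m + i + j - 1) (i, j) = inverse (f m (a + 1 - i, b + 1 - j))"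
      using reciprocity[OF f ij, of m]
      by (intro inverse_unique[symmetric]) (simp add: mult.commute)
    moreover have "0 < f m (a + 1 - i, b + 1 - j)"
      using ij by (intro row_orbit_pos[OF f]) (auto simp: mem_rect)
    ultimately show "ln (f (m + (i + j - 1)) (i, j)) = - ln (f m (a + 1 - i, b + 1 - j))"
      by (simp add: ln_inverse)
  qed simp
  finally show ?thesis by (simp add: sum_negf)
qed

section \<open>Shearing between rowmotion and promotion orbits\<close>

text \<open>Delaying column \<open>j\<close> by \<open>j\<close> moves the columns
  \<open>j + 1\<close> and \<open>j - 1\<close> by one step relative to column \<open>j\<close>,
  which turns the old/new pattern of rowmotion into that of promotion.\<close>

lemma pro_orbit_of_row_orbit:
  assumes f: "row_orbit a b f"
  shows "pro_orbit a b (\<lambda>m (i, j). f (m + j) (i, j))"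
  unfolding pro_orbit_def
proof (intro conjI allI impI ballI)
  fix m x
  assume "x \<in> rect a b"
  then show "0 < (case x of (i, j) \<Rightarrow> f (m + j) (i, j))"
    using row_orbit_pos[OF f] by (cases x) simp
next
  fix m i j
  assume ij: "(i, j) \<in> rect a b"
  then show "(case (i, j) of (i, j) \<Rightarrow> f (Suc m + j) (i, j)) *
      (case (i, j) of (i, j) \<Rightarrow> f (m + j) (i, j)) *
      (upper_inv a b (\<lambda>(i, j). f (Suc m + j) (i, j)) (Suc i) j + upper_inv a b (\<lambda>(i, j). f (m + j) (i, j)) i (Suc j)) =
      lower_val (\<lambda>(i, j). f (m + j) (i, j)) (i - 1) j + lower_val (\<lambda>(i, j). f (Suc m + j) (i, j)) i (j - 1)"
    using row_orbit_step[OF f ij, of "m + j"]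
    by (auto simp: upper_inv_def lower_val_def mem_rect split: if_splits)
qed

text \<open>The inverse shear, delayed by \<open>b\<close> so that all times stay natural
  numbers.\<close>

lemma row_orbit_of_pro_orbit:
  assumes g: "pro_orbit a b g"
  shows "row_orbit a b (\<lambda>m (i, j). g (m + (b - j)) (i, j))"
  unfolding row_orbit_def
proof (intro conjI allI impI ballI)
  fix m x
  assume "x \<in> rect a b"
  then show "0 < (case x of (i, j) \<Rightarrow> g (m + (b - j)) (i, j))"
    using g by (cases x) (simp add: pro_orbit_def)
next
  fix m i j
  assume ij: "(i, j) \<in> rect a b"
  have "j < b \<Longrightarrow> b - j = Suc (b - Suc j)" "1 < j \<Longrightarrow> b - (j - 1) = Suc (b - j)"
    using ij by (auto simp: mem_rect)
  moreover have "g (Suc (m + (b - j))) (i, j) * g (m + (b - j)) (i, j) *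
      (upper_inv a b (g (Suc (m + (b - j)))) (Suc i) j + upper_inv a b (g (m + (b - j))) i (Suc j))
     = lower_val (g (m + (b - j))) (i - 1) j + lower_val (g (Suc (m + (b - j)))) i (j - 1)"
    using g ij unfolding pro_orbit_def by blast
  ultimately show "(case (i, j) of (i, j) \<Rightarrow> g (Suc m + (b - j)) (i, j)) *
      (case (i, j) of (i, j) \<Rightarrow> g (m + (b - j)) (i, j)) *
      (upper_inv a b (\<lambda>(i, j). g (Suc m + (b - j)) (i, j)) (Suc i) j +
       upper_inv a b (\<lambda>(i, j). g (Suc m + (b - j)) (i, j)) i (Suc j)) =
      lower_val (\<lambda>(i, j). g (m + (b - j)) (i, j)) (i - 1) j + lower_val (\<lambda>(i, j). g (m + (b - j)) (i, j)) i (j - 1)"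
    using ij by (auto simp: upper_inv_def lower_val_def mem_rect split: if_splits)
qed

lemma bpro_row_orbit:
  assumes "\<And>x. x \<in> rect a b \<Longrightarrow> 0 < f x"
  obtains F where "row_orbit a b F"
    and "\<And>m i j. (i, j) \<in> rect a b \<Longrightarrow> (bpro a b ^^ m) f (i, j) = F (m + j) (i, j)"
proof -
  \<comment> \<open>The shear needs the orbit up to $b$ steps before \<open>f\<close>.\<close>
  obtain h where h: "\<forall>x\<in>rect a b. 0 < h x" and hf: "(bpro a b ^^ b) h = f"
    using bpro_surj[of a b f b] assms by blast
  define g where "g m = (bpro a b ^^ m) h" for m
  have "pro_orbit a b g" unfolding g_def using h by (intro pro_orbit_bpro) auto
  then have "row_orbit a b (\<lambda>m (i, j). g (m + (b - j)) (i, j))"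
    by (rule row_orbit_of_pro_orbit)
  moreover have "(bpro a b ^^ m) f = g (m + b)" for m
    by (simp add: g_def funpow_add hf)
  ultimately show ?thesis by (intro that) (auto simp: mem_rect)
qed

section \<open>Sums along files\<close>

definition file_set :: "nat \<Rightarrow> nat \<Rightarrow> nat \<Rightarrow> elt set" where
  "file_set a b k = {(i, j). (i, j) \<in> rect a b \<and> j + a = k + i}"

text \<open>\<open>(r, j)\<close> is the lower corner of a unit square and \<open>(u, v)\<close>
  selects one of its corners. That corner runs exactly once through its file, as positions outside
  the rectangle count 0.\<close>

lemma sum_file_shift:
  fixes h :: "elt \<Rightarrow> real"
  assumes "u \<le> 1" "v \<le> 1" "k' + u = k + v"
  shows "(\<Sum>(r, j)\<in>{(r, j). r \<le> a \<and> j \<le> b \<and> j + a = k + r}.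
      if (r + u, j + v) \<in> rect a b then h (r + u, j + v) else 0) = sum h (file_set a b k')"
    (is "sum _ ?E = _")
proof -
  have fin: "finite ?E" by (rule finite_subset[of _ "{..a} \<times> {..b}"]) auto
  have "(\<Sum>(r, j)\<in>?E. if (r + u, j + v) \<in> rect a b then h (r + u, j + v) else 0) =
      (\<Sum>x\<in>?E. if (fst x + u, snd x + v) \<in> rect a b then h (fst x + u, snd x + v) else 0)"
    by (simp add: case_prod_beta)
  also have "\<dots> = (\<Sum>x\<in>{x\<in>?E. (fst x + u, snd x + v) \<in> rect a b}. h (fst x + u, snd x + v))"
    by (rule sum.inter_filter[OF fin, symmetric])
  also have "\<dots> = sum h (file_set a b k')"
    by (rule sum.reindex_bij_witness[where i = "\<lambda>(i, j). (i - u, j - v)" and j = "\<lambda>(r, j). (r + u, j + v)"])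
      (use assms in \<open>auto simp: file_set_def mem_rect\<close>)
  finally show ?thesis .
qed

text \<open>The sum runs over all unit squares on the file, including those that stick out of the
  rectangle: the upper covers of the lower corner of a square are the lower covers of its upper
  corner, and $\ln(u+v) - \ln(1/u+1/v) = \ln u + \ln v$.\<close>

lemma pro_orbit_file_sums:
  assumes g: "pro_orbit a b g" and k: "1 \<le> k" "k < a + b" and a: "1 \<le> a" and b: "1 \<le> b"
  shows "(\<Sum>x\<in>file_set a b k. ln (g (Suc m) x)) + (\<Sum>x\<in>file_set a b k. ln (g m x)) =
    (\<Sum>x\<in>file_set a b (k - 1). ln (g (Suc m) x)) + (\<Sum>x\<in>file_set a b (k + 1). ln (g m x))"
proof -
  have pos: "0 < g t x" if "x \<in> rect a b" for t x
    using g that by (simp add: pro_orbit_def)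
  define L where "L = (\<lambda>(i, j). ln (lower_val (g m) (i - 1) j + lower_val (g (Suc m)) i (j - 1)))"
  define H where "H = (\<lambda>(i, j). ln (upper_inv a b (g (Suc m)) (Suc i) j + upper_inv a b (g m) i (Suc j)))"
  have ln_step: "ln (g (Suc m) x) + ln (g m x) = L x - H x" if "x \<in> rect a b" for x
  proof -
    obtain i j where x: "x = (i, j)" by force
    with that have ij: "(i, j) \<in> rect a b" by simp
    let ?h = "upper_inv a b (g (Suc m)) (Suc i) j + upper_inv a b (g m) i (Suc j)"
    \<comment> \<open>\<open>upper_sum_pos\<close> speaks of one labelling, but the two summands
      belong to different times.\<close>
    let ?mix = "\<lambda>z. if z = (Suc i, j) then g (Suc m) z else g m z"
    have "0 < upper_inv a b ?mix (Suc i) j + upper_inv a b ?mix i (Suc j)"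
      by (rule upper_sum_pos[OF ij]) (auto simp: pos)
    moreover have "upper_inv a b ?mix (Suc i) j = upper_inv a b (g (Suc m)) (Suc i) j"
      "upper_inv a b ?mix i (Suc j) = upper_inv a b (g m) i (Suc j)"
      by (simp_all add: upper_inv_def)
    ultimately have h: "0 < ?h" by simp
    have "g (Suc m) (i, j) * g m (i, j) * ?h = lower_val (g m) (i - 1) j + lower_val (g (Suc m)) i (j - 1)"
      using g ij unfolding pro_orbit_def by blast
    then have "L x = ln (g (Suc m) (i, j) * g m (i, j) * ?h)" by (simp add: L_def x)
    also have "\<dots> = ln (g (Suc m) x) + ln (g m x) + H x"
      using h pos[OF ij, of m] pos[OF ij, of "Suc m"] by (simp add: H_def x ln_mult)
    finally show ?thesis by simp
  qed
  let ?E = "{(r, j). r \<le> a \<and> j \<le> b \<and> j + a = k + r}"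
  let ?on = "\<lambda>(h :: elt \<Rightarrow> real) x. if x \<in> rect a b then h x else 0"
  have square: "?on L (r + 1, j + 1) - ?on H (r + 0, j + 0) =
      ?on (\<lambda>x. ln (g (Suc m) x)) (r + 1, j + 0) + ?on (\<lambda>x. ln (g m x)) (r + 0, j + 1)"
    if rj: "r \<le> a" "j \<le> b" "j + a = k + r" for r j
  proof -
    \<comment> \<open>The squares at \<open>(0, b)\<close> and \<open>(a, 0)\<close> would lie on
      the files \<open>a + b\<close> and 0, which \<open>k\<close> avoids.\<close>
    consider "r = 0" "j = 0" | "r = 0" "1 \<le> j" "j < b" | "r = a" "j = b" | "r = a" "1 \<le> j" "j < b"
      | "j = 0" "1 \<le> r" "r < a" | "j = b" "1 \<le> r" "r < a" | "1 \<le> r" "r < a" "1 \<le> j" "j < b"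
    proof -
      have "(r = 0 \<and> (j = 0 \<or> 1 \<le> j \<and> j < b)) \<or> (r = a \<and> (j = b \<or> 1 \<le> j \<and> j < b)) \<or>
          (1 \<le> r \<and> r < a \<and> (j = 0 \<or> j = b \<or> 1 \<le> j \<and> j < b))"
        using rj k by linarith
      then show thesis using that by blast
    qed
    then show ?thesis
    proof cases
      case 7
      then have "0 < g (Suc m) (Suc r, j)" "0 < g m (r, Suc j)" by (auto intro!: pos simp: mem_rect)
      moreover from this have "1 / g (Suc m) (Suc r, j) + 1 / g m (r, Suc j) =
          (g m (r, Suc j) + g (Suc m) (Suc r, j)) / (g (Suc m) (Suc r, j) * g m (r, Suc j))"
        by (simp add: field_simps)
      ultimately show ?thesis
        using 7 by (simp add: L_def H_def lower_val_def upper_inv_def mem_rect ln_div ln_mult add_pos_pos)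
    qed (use a b pos in \<open>auto simp: L_def H_def lower_val_def upper_inv_def mem_rect ln_div\<close>)
  qed
  have "(\<Sum>x\<in>file_set a b k. ln (g (Suc m) x)) + (\<Sum>x\<in>file_set a b k. ln (g m x)) =
      (\<Sum>x\<in>file_set a b k. L x - H x)"
    unfolding sum.distrib[symmetric] by (rule sum.cong) (auto simp: file_set_def ln_step)
  also have "\<dots> = (\<Sum>(r, j)\<in>?E. ?on L (r + 1, j + 1)) - (\<Sum>(r, j)\<in>?E. ?on H (r + 0, j + 0))"
    using sum_file_shift[of 1 1 k k a b L] sum_file_shift[of 0 0 k k a b H] by (simp add: sum_subtractf)
  also have "\<dots> = (\<Sum>(r, j)\<in>?E. ?on (\<lambda>x. ln (g (Suc m) x)) (r + 1, j + 0)) +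
      (\<Sum>(r, j)\<in>?E. ?on (\<lambda>x. ln (g m x)) (r + 0, j + 1))"
    unfolding sum_subtractf[symmetric] sum.distrib[symmetric]
    by (rule sum.cong) (use square in auto)
  also have "\<dots> = (\<Sum>x\<in>file_set a b (k - 1). ln (g (Suc m) x)) + (\<Sum>x\<in>file_set a b (k + 1). ln (g m x))"
    using k sum_file_shift[of 1 0 "k - 1" k a b "\<lambda>x. ln (g (Suc m) x)"]
      sum_file_shift[of 0 1 "k + 1" k a b "\<lambda>x. ln (g m x)"] by simp
  finally show ?thesis .
qed

lemma row_orbit_file_sum:
  assumes f: "row_orbit a b f" and k: "k \<le> a + b" and a: "1 \<le> a" and b: "1 \<le> b"
  shows "(\<Sum>m<a+b. \<Sum>x\<in>file_set a b k. ln (f m x)) = 0"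
proof -
  define g where "g = (\<lambda>m (i, j). f (m + j) (i, j))"
  have g: "pro_orbit a b g"
    unfolding g_def by (rule pro_orbit_of_row_orbit[OF f])
  have per: "g (m + (a + b)) x = g m x" if "x \<in> rect a b" for m x
  proof -
    obtain i j where x: "x = (i, j)" by force
    show ?thesis
      using row_orbit_periodic[OF f that, of "m + j"] by (simp add: g_def x add.commute add.left_commute)
  qed
  define S where "S k = (\<Sum>m<a+b. \<Sum>x\<in>file_set a b k. ln (g m x))" for k
  have S_Suc: "(\<Sum>m<a+b. \<Sum>x\<in>file_set a b k. ln (g (Suc m) x)) = S k" for k
  proof -
    have "(\<Sum>x\<in>file_set a b k. ln (g (m + (a + b)) x)) = (\<Sum>x\<in>file_set a b k. ln (g m x))" for m
      by (rule sum.cong) (auto simp: file_set_def per)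
    from sum_periodic_shift[of "\<lambda>m. \<Sum>x\<in>file_set a b k. ln (g m x)", OF this, of 1] show ?thesis by (simp add: S_def)
  qed
  have rec: "2 * S k = S (k - 1) + S (k + 1)" if "1 \<le> k" "k < a + b" for k
  proof -
    have "S k + S k = (\<Sum>m<a+b. (\<Sum>x\<in>file_set a b k. ln (g (Suc m) x)) + (\<Sum>x\<in>file_set a b k. ln (g m x)))"
      by (simp add: sum.distrib S_Suc) (simp add: S_def)
    also have "\<dots> = S (k - 1) + S (k + 1)"
      by (simp only: pro_orbit_file_sums[OF g that a b] sum.distrib S_Suc) (simp add: S_def)
    finally show ?thesis by simp
  qed
  have "file_set a b 0 = {}" "file_set a b (a + b) = {}" by (auto simp: file_set_def mem_rect)
  then have S0: "S 0 = 0" and Sn: "S (a + b) = 0" by (simp_all add: S_def)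
  \<comment> \<open>Second differences of \<open>S\<close> vanish and \<open>S 0 = 0\<close>, so
    \<open>S\<close> is linear in \<open>k\<close>; \<open>S (a + b) = 0\<close> makes the slope
    zero.\<close>
  have lin: "k \<le> a + b \<Longrightarrow> S k = real k * S 1" for k
  proof (induction k rule: less_induct)
    case (less k)
    consider "k = 0" | "k = 1" | l where "k = Suc (Suc l)" by (metis One_nat_def not0_implies_Suc)
    then show ?case
    proof cases
      case 3
      then have "S k = 2 * S (Suc l) - S l" using rec[of "Suc l"] less.prems by simp
      then show ?thesis using less.IH[of "Suc l"] less.IH[of l] less.prems 3 by (simp add: algebra_simps)
    qed (simp_all add: S0)
  qed
  from lin[of "a + b"] have "S 1 = 0" using Sn a by simp
  with lin[OF k] have "S k = 0" by simp
  also have "S k = (\<Sum>x\<in>file_set a b k. \<Sum>m<a+b. ln (g m x))"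
    unfolding S_def by (rule sum.swap)
  also have "\<dots> = (\<Sum>x\<in>file_set a b k. \<Sum>m<a+b. ln (f m x))"
  proof (rule sum.cong)
    fix x
    assume "x \<in> file_set a b k"
    then have x: "x \<in> rect a b" by (auto simp: file_set_def)
    \<comment> \<open>The shear delays each element by a fixed time, which a sum over a full period
      does not see.\<close>
    have "g m x = f (m + snd x) x" for m by (simp add: g_def case_prod_beta)
    then show "(\<Sum>m<a+b. ln (g m x)) = (\<Sum>m<a+b. ln (f m x))"
      using sum_periodic_shift[of "\<lambda>m. ln (f m x)" "a + b" "snd x"] row_orbit_periodic[OF f x] by simp
  qed simp
  finally show ?thesis using sum.swap[of "\<lambda>m x. ln (f m x)" "file_set a b k" "{..<a+b}"] by simp
qed

section \<open>The functionals summed over a period\<close>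

text \<open>Common form of both kinds of orbits: delay 0 for rowmotion, the column for promotion.
  The logarithms split into single elements, so delays drop out of sums over a period.\<close>

definition shifted_row_orbit :: "nat \<Rightarrow> nat \<Rightarrow> (nat \<Rightarrow> elt \<Rightarrow> real) \<Rightarrow> bool" where
  "shifted_row_orbit a b G \<longleftrightarrow>
     (\<exists>F s. row_orbit a b F \<and> (\<forall>m. \<forall>x\<in>rect a b. G m x = F (m + s x) x))"

lemma F_ij_sum:
  assumes "shifted_row_orbit a b G" and ij: "(i, j) \<in> rect a b"
  shows "(\<Sum>m<a+b. F_ij a b i j (G m)) = 0"
proof -
  obtain F s where F: "row_orbit a b F" and G: "\<And>m x. x \<in> rect a b \<Longrightarrow> G m x = F (m + s x) x"
    using assms(1) unfolding shifted_row_orbit_def by blast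
  let ?x = "(i, j)" and ?y = "(a + 1 - i, b + 1 - j)"
  have y: "?y \<in> rect a b" using ij by (auto simp: mem_rect)
  have shift: "(\<Sum>m<a+b. ln (F (m + s x) x)) = (\<Sum>m<a+b. ln (F m x))" if "x \<in> rect a b" for x
    by (rule sum_periodic_shift) (simp add: row_orbit_periodic[OF F that])
  have "F_ij a b i j (G m) = ln (F (m + s ?x) ?x) + ln (F (m + s ?y) ?y)" for m
    unfolding F_ij_def G[OF ij] G[OF y]
    using row_orbit_pos[OF F ij] row_orbit_pos[OF F y] by (intro ln_mult_pos)
  then show ?thesis
    by (simp only: sum.distrib shift[OF ij] shift[OF y] row_orbit_antipodal_sum[OF F ij])
qed

lemma F_k_sum:
  assumes "shifted_row_orbit a b G" and k: "k \<le> a + b" and ab: "1 \<le> a" "1 \<le> b"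
  shows "(\<Sum>m<a+b. F_k a b k (G m)) = 0"
proof -
  obtain F s where F: "row_orbit a b F" and G: "\<And>m x. x \<in> rect a b \<Longrightarrow> G m x = F (m + s x) x"
    using assms(1) unfolding shifted_row_orbit_def by blast
  have file_set_eq: "{(i, j). (i, j) \<in> rect a b \<and> int j - int i = int k - int a} = file_set a b k"
    by (auto simp: file_set_def)
  have rect: "x \<in> rect a b" if "x \<in> file_set a b k" for x
    using that by (auto simp: file_set_def)
  have fin: "finite (file_set a b k)"
    by (rule finite_subset[OF _ finite_rect[of a b]]) (auto simp: rect)
  have "F_k a b k (G m) = (\<Sum>x\<in>file_set a b k. ln (F (m + s x) x))" for m
  proof -
    have "F_k a b k (G m) = ln (\<Prod>x\<in>file_set a b k. F (m + s x) x)"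
      by (simp add: F_k_def file_set_eq G rect cong: prod.cong)
    also have "\<dots> = (\<Sum>x\<in>file_set a b k. ln (F (m + s x) x))"
      using fin row_orbit_pos[OF F rect, THEN less_imp_neq] row_orbit_pos[OF F rect] by (intro ln_prod) auto
    finally show ?thesis .
  qed
  then have "(\<Sum>m<a+b. F_k a b k (G m)) = (\<Sum>x\<in>file_set a b k. \<Sum>m<a+b. ln (F (m + s x) x))"
    by (simp add: sum.swap[of _ "file_set a b k"])
  also have "\<dots> = (\<Sum>x\<in>file_set a b k. \<Sum>m<a+b. ln (F m x))"
    by (intro sum.cong sum_periodic_shift) (simp_all add: row_orbit_periodic[OF F] rect)
  also have "\<dots> = 0"
    using row_orbit_file_sum[OF F k ab] sum.swap[of "\<lambda>m x. ln (F m x)" "file_set a b k" "{..<a+b}"] by simp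
  finally show ?thesis .
qed

theorem theorem9:
  fixes a b :: nat
  assumes "1 \<le> a" and "1 \<le> b"
  shows "(\<forall>L f i j. linear_extension (rect a b) L \<and> (\<forall>x\<in>rect a b. f x > 0)
            \<and> 1 \<le> i \<and> i \<le> a \<and> 1 \<le> j \<and> j \<le> b \<longrightarrow>
            (\<Sum>m<a+b. F_ij a b i j ((brow (rect a b) L ^^ m) f)) = 0
          \<and> (\<Sum>m<a+b. F_ij a b i j ((bpro a b ^^ m) f)) = 0)
       \<and> (\<forall>L f k. linear_extension (rect a b) L \<and> (\<forall>x\<in>rect a b. f x > 0)
            \<and> 1 \<le> k \<and> k \<le> a + b - 1 \<longrightarrow>
            (\<Sum>m<a+b. F_k a b k ((brow (rect a b) L ^^ m) f)) = 0
          \<and> (\<Sum>m<a+b. F_k a b k ((bpro a b ^^ m) f)) = 0)"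
proof -
  have brow: "shifted_row_orbit a b (\<lambda>m. (brow (rect a b) L ^^ m) f)"
    if "linear_extension (rect a b) L" "\<forall>x\<in>rect a b. f x > 0" for L f
    unfolding shifted_row_orbit_def using row_orbit_brow[of a b L f] that
    by (intro exI[of _ "\<lambda>m. (brow (rect a b) L ^^ m) f"] exI[of _ "\<lambda>_. 0"]) auto
  have bpro: "shifted_row_orbit a b (\<lambda>m. (bpro a b ^^ m) f)" if pos: "\<forall>x\<in>rect a b. f x > 0" for f
  proof -
    obtain F where "row_orbit a b F"
      and "\<And>m i j. (i, j) \<in> rect a b \<Longrightarrow> (bpro a b ^^ m) f (i, j) = F (m + j) (i, j)"
      using bpro_row_orbit[of a b f] pos by blast
    then show ?thesis
      unfolding shifted_row_orbit_def by (intro exI[of _ F] exI[of _ snd]) auto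
  qed
  show ?thesis
    by (intro conjI allI impI F_ij_sum F_k_sum brow bpro) (use assms in \<open>auto simp: mem_rect\<close>)
qed

end
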